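(* Let $D>0$. Then there is a smooth curve $\gamma:[0,2\pi]\to\mathbb{R}^2$, parametrized by arclength, such that for each $r\in(0,D)$ the $r$-lifting $L_r(\gamma)$ is not injective and appropriate restrictions of $L_r(\gamma)$ (to subintervals of $[0,2\pi]$) intersect each other transversally.
   Context: $\mathbb{S}^2(r)$ denotes the sphere of radius $r$ centered at $0$ in $\mathbb{R}^3$, with a fixed orientation. For a regular plane curve $c$ defined on an interval $I\ni0$, the $r$-lifting $L_r(c):I\to\mathbb{S}^2(r)$ is the curve with $L_r(c)(0)=(r,0,0)$, $(L_r(c))'(0)\in\mathbb{R}\cdot(0,1,0)$, $\|(L_r(c))'(t)\|=\|c'(t)\|$ for all $t$, and $\kappa_{L_r(c)}(t)=\kappa_c(t)$ for all $t$, where $\kappa$ is the signed (geodesic) curvature in $\mathbb{S}^2(r)$ resp. $\mathbb{R}^2$. That appropriate restrictions of a curve $\beta$ intersect each other transversally means that there are two subintervals of its domain such that the restrictions of $\beta$ to them meet, and do so with linearly independent tangent vectors. *)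

theory Defs
  imports "HOL-Analysis.Analysis"
begin

text \<open>Derivatives are taken within the domain of the curve, hence are one-sided at the end points
  of a closed interval.\<close>

definition velocity :: "real set \<Rightarrow> (real \<Rightarrow> 'a::real_normed_vector) \<Rightarrow> real \<Rightarrow> 'a"
  where "velocity I c t = vector_derivative c (at t within I)"

definition smooth_curve_on :: "real set \<Rightarrow> (real \<Rightarrow> 'a::real_normed_vector) \<Rightarrow> bool"
  where "smooth_curve_on I c \<longleftrightarrow> (\<forall>n. (velocity I ^^ n) c differentiable_on I)"

definition regular_curve_on :: "real set \<Rightarrow> (real \<Rightarrow> 'a::real_normed_vector) \<Rightarrow> bool"
  where "regular_curve_on I c \<longleftrightarrow> smooth_curve_on I c \<and> (\<forall>t\<in>I. velocity I c t \<noteq> 0)"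

definition plane_curvature :: "real set \<Rightarrow> (real \<Rightarrow> real^2) \<Rightarrow> real \<Rightarrow> real"
  where "plane_curvature I c t =
    det (vector [velocity I c t, velocity I (velocity I c) t] :: real^2^2) /
    norm (velocity I c t) ^ 3"

text \<open>The sphere of radius \<open>r\<close> about the origin is oriented by its outward unit normal
  \<open>N = L t / r\<close>; the geodesic curvature is the component of the acceleration along
  the conormal \<open>N \<times> T\<close>, where \<open>T\<close> is the unit tangent, divided by the squared speed.\<close>

definition sphere_curvature :: "real \<Rightarrow> real set \<Rightarrow> (real \<Rightarrow> real^3) \<Rightarrow> real \<Rightarrow> real"
  where "sphere_curvature r I L t =
    (cross3 (L t /\<^sub>R r) (velocity I L t) \<bullet> velocity I (velocity I L) t) /
    norm (velocity I L t) ^ 3"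

text \<open>Since the initial velocity is only required to lie on the line \<open>\<real> \<cdot> (0,1,0)\<close>, a lifting is
  determined only up to the half turn about the first coordinate axis. It is therefore
  treated as a relation.\<close>

definition is_lifting :: "real \<Rightarrow> real set \<Rightarrow> (real \<Rightarrow> real^2) \<Rightarrow> (real \<Rightarrow> real^3) \<Rightarrow> bool"
  where "is_lifting r I c L \<longleftrightarrow>
    smooth_curve_on I L \<and>
    L ` I \<subseteq> sphere 0 r \<and>
    L 0 = vector [r, 0, 0] \<and>
    velocity I L 0 \<in> span {vector [0, 1, 0]} \<and>
    (\<forall>t\<in>I. norm (velocity I L t) = norm (velocity I c t)) \<and>
    (\<forall>t\<in>I. sphere_curvature r I L t = plane_curvature I c t)"

text \<open>The condition \<open>velocity I L s \<noteq> velocity I L t\<close> is needed because the set of two equal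
  nonzero vectors is a singleton and hence \<open>independent\<close>. At a common parameter the two
  velocities coincide, so the two intervals are forced to be disjoint.\<close>

definition has_transversal_restrictions :: "real set \<Rightarrow> (real \<Rightarrow> real^3) \<Rightarrow> bool"
  where "has_transversal_restrictions I L \<longleftrightarrow>
    (\<exists>a b a' b'. a < b \<and> {a..b} \<subseteq> I \<and> a' < b' \<and> {a'..b'} \<subseteq> I \<and>
      L ` {a..b} \<inter> L ` {a'..b'} \<noteq> {} \<and>
      (\<forall>s\<in>{a..b}. \<forall>t\<in>{a'..b'}. L s = L t \<longrightarrow>
        velocity I L s \<noteq> velocity I L t \<and> independent {velocity I L s, velocity I L t}))"

end

theory Submission imports Defs
begin

text \<open>Take \<open>\<gamma>\<close> of curvature \<open>\<kappa> t = 2 - cos t\<close>; it works for every radius. Since \<open>\<kappa>\<close> is symmetric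
  about \<open>\<pi>\<close>, any lift is symmetric under the reflection in the plane through the origin
  orthogonal to its velocity at \<open>\<pi>\<close>, so it meets itself as soon as it returns to that plane.
  It does return by time \<open>2 \<pi>\<close>, by Sturm comparison with \<open>sin\<close> and \<open>\<kappa> \<ge> 1\<close>. As \<open>\<kappa>\<close> is strictly
  decreasing on \<open>{\<pi>..2 \<pi>}\<close>, the lift crosses the plane at an oblique angle on its
  first return, which makes the self-intersection transversal.\<close>

section \<open>Initial value problems with a global Lipschitz bound\<close>

text \<open>Because one Lipschitz constant serves the whole strip, a single fixed point of the
  Picard operator gives a solution on all of \<open>{a..b}\<close>, and no local solutions have to
  be glued.\<close>

lemma global_lipschitz_ivp:
  fixes f :: "real \<Rightarrow> 'a::banach \<Rightarrow> 'a"
  assumes cont: "continuous_on ({a..b} \<times> UNIV) (\<lambda>(t, x). f t x)"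
    and lip: "\<And>t x y. t \<in> {a..b} \<Longrightarrow> norm (f t x - f t y) \<le> M * norm (x - y)"
    and "a \<le> b" "M > 0"
  obtains x where "x a = x0"
    and "\<And>t. t \<in> {a..b} \<Longrightarrow> (x has_vector_derivative f t (x t)) (at t within {a..b})"
proof -
  \<comment> \<open>The exponential weight makes the Picard operator a contraction on the whole interval.\<close>
  define h where "h g s = f s (exp (2*M * s) *\<^sub>R apply_bcontfun g s)" for g :: "(real, 'a) bcontfun" and s
  define J where "J g c = x0 + integral {a..c} (h g)" for g c
  \<comment> \<open>Clamping time to \<open>{a..b}\<close> lets the operator act on bounded
    continuous functions on the whole line, which form a complete space.\<close>
  define q where "q t = max a (min b t)" for t
  define G where "G g = Bcontfun (\<lambda>t. exp (- (2*M*q t)) *\<^sub>R J g (q t))" for g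
  have q: "q t \<in> {a..b}" for t
    using \<open>a \<le> b\<close> by (auto simp: q_def)
  have q_id: "q t = t" if "t \<in> {a..b}" for t
    using that by (auto simp: q_def)
  have h_cont: "continuous_on {a..b} (h g)" for g
  proof -
    have "continuous_on {a..b} ((\<lambda>(t, x). f t x) \<circ> (\<lambda>s. (s, exp (2*M * s) *\<^sub>R apply_bcontfun g s)))"
      by (intro continuous_on_compose continuous_on_subset[OF cont] continuous_intros
          continuous_on_apply_bcontfun) auto
    then show ?thesis
      by (simp add: o_def h_def[abs_def])
  qed
  have J_deriv: "(J g has_vector_derivative h g t) (at t within {a..b})" if "t \<in> {a..b}" for g t
    unfolding J_def using integral_has_vector_derivative[OF h_cont that, of g]
    by (auto intro!: derivative_eq_intros)
  have J_cont: "continuous_on {a..b} (J g)" for g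
    using J_deriv by (meson continuous_on_eq_continuous_within has_vector_derivative_continuous)
  have "(\<lambda>t. exp (- (2*M*q t)) *\<^sub>R J g (q t)) \<in> bcontfun" for g
  proof -
    have c: "continuous_on {a..b} (\<lambda>t. exp (- (2*M*t)) *\<^sub>R J g t)"
      by (intro continuous_intros J_cont)
    have "continuous_on UNIV q"
      unfolding q_def by (intro continuous_intros)
    then have "continuous_on UNIV ((\<lambda>t. exp (- (2*M*t)) *\<^sub>R J g t) \<circ> q)"
      using q by (intro continuous_on_compose continuous_on_subset[OF c]) auto
    moreover have "bounded (range ((\<lambda>t. exp (- (2*M*t)) *\<^sub>R J g t) \<circ> q))"
      using compact_imp_bounded[OF compact_continuous_image[OF c compact_Icc]]
      by (rule bounded_subset) (use q in auto)
    ultimately show ?thesis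
      by (simp add: bcontfun_def o_def)
  qed
  then have G: "apply_bcontfun (G g) t = exp (- (2*M*q t)) *\<^sub>R J g (q t)" for g t
    by (simp add: G_def Bcontfun_inverse)
  \<comment> \<open>The integral of \<open>M*d*exp (2*M * s)\<close> up to \<open>c\<close> is at
    most \<open>d/2 * exp (2*M*c)\<close>, and the outer weight cancels the exponential. The rate
    \<open>2*M\<close> is what produces the factor 1/2.\<close>
  have "dist (G g1) (G g2) \<le> 1/2 * dist g1 g2" for g1 g2
  proof (rule dist_bound)
    fix t
    define c where "c = q t"
    define d where "d = dist g1 g2"
    have c: "c \<in> {a..b}" "{a..c} \<subseteq> {a..b}"
      using q[of t] by (auto simp: c_def)
    have int: "h g integrable_on {a..c}" for g
      using continuous_on_subset[OF h_cont c(2)] by (rule integrable_continuous_real)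
    have deriv: "((\<lambda>s. d/2 * exp (2*M * s)) has_vector_derivative (M*d*exp (2*M * s))) (at s within {a..c})" for s
      by (rule has_real_derivative_iff_has_vector_derivative[THEN iffD1])
        (auto intro!: derivative_eq_intros)
    have I: "((\<lambda>s. M*d*exp (2*M * s)) has_integral (d/2 * exp (2*M*c) - d/2 * exp (2*M*a))) {a..c}"
      using c by (intro fundamental_theorem_of_calculus deriv) auto
    have "norm (integral {a..c} (\<lambda>s. h g1 s - h g2 s)) \<le> integral {a..c} (\<lambda>s. M*d*exp (2*M * s))"
    proof (rule integral_norm_bound_integral)
      show "(\<lambda>s. h g1 s - h g2 s) integrable_on {a..c}"
        by (intro integrable_diff int)
      show "(\<lambda>s. M*d*exp (2*M * s)) integrable_on {a..c}"
        using I by blast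
      fix s assume s: "s \<in> {a..c}"
      have "norm (h g1 s - h g2 s) \<le>
          M * norm (exp (2*M * s) *\<^sub>R apply_bcontfun g1 s - exp (2*M * s) *\<^sub>R apply_bcontfun g2 s)"
        unfolding h_def using s c by (intro lip) auto
      also have "\<dots> = M * (exp (2*M * s) * dist (apply_bcontfun g1 s) (apply_bcontfun g2 s))"
        by (simp flip: scaleR_diff_right add: dist_norm)
      also have "\<dots> \<le> M * (exp (2*M * s) * d)"
        unfolding d_def using \<open>M > 0\<close> by (intro mult_left_mono dist_bounded) auto
      finally show "norm (h g1 s - h g2 s) \<le> M*d*exp (2*M * s)"
        by (simp add: mult_ac)
    qed
    also have "\<dots> = d/2 * exp (2*M*c) - d/2 * exp (2*M*a)"
      using I by (rule integral_unique)
    also have "\<dots> \<le> d/2 * exp (2*M*c)"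
      by (simp add: d_def)
    finally have *: "norm (J g1 c - J g2 c) \<le> d/2 * exp (2*M*c)"
      by (simp add: J_def integral_diff[OF int int])
    have "dist (apply_bcontfun (G g1) t) (apply_bcontfun (G g2) t) = exp (- (2*M*c)) * norm (J g1 c - J g2 c)"
      by (simp add: G c_def dist_norm flip: scaleR_diff_right)
    also have "\<dots> \<le> exp (- (2*M*c)) * (d/2 * exp (2*M*c))"
      using * by (rule mult_left_mono) simp
    also have "\<dots> = d/2"
      by (simp add: exp_minus)
    finally show "dist (apply_bcontfun (G g1) t) (apply_bcontfun (G g2) t) \<le> 1/2 * dist g1 g2"
      by (simp add: d_def)
  qed
  then obtain g where g: "G g = g"
    using banach_fix_type[of "1/2" G] by auto
  \<comment> \<open>The fixed point is the solution times the decaying weight, so \<open>J g\<close>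
    is the solution itself.\<close>
  have J_eq: "J g t = exp (2*M*t) *\<^sub>R apply_bcontfun g t" if "t \<in> {a..b}" for t
    using arg_cong[OF g, of "\<lambda>u. exp (2*M*t) *\<^sub>R apply_bcontfun u t"] G[of g t] q_id[OF that]
    by (simp add: exp_minus)
  show thesis
  proof (rule that)
    show "J g a = x0"
      by (simp add: J_def)
    show "(J g has_vector_derivative f t (J g t)) (at t within {a..b})" if "t \<in> {a..b}" for t
      using J_deriv[OF that, of g] J_eq[OF that] by (simp add: h_def)
  qed
qed

section \<open>Velocities and smoothness on a closed interval\<close>

lemma velocity_eqI:
  fixes c :: "real \<Rightarrow> 'a::real_normed_vector"
  assumes "a < b" "t \<in> {a..b}" "(c has_vector_derivative v) (at t within {a..b})"
  shows "velocity {a..b} c t = v"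
  unfolding velocity_def using assms vector_derivative_within_cbox[of a b t c v] by simp

text \<open>Both velocities are chosen from the same set of derivatives, so they agree even where
  that set is empty.\<close>

lemma velocity_cong:
  fixes c :: "real \<Rightarrow> 'a::real_normed_vector"
  assumes "t \<in> I" "\<And>s. s \<in> I \<Longrightarrow> c s = d s"
  shows "velocity I c t = velocity I d t"
proof -
  have "(c has_vector_derivative v) (at t within I) \<longleftrightarrow> (d has_vector_derivative v) (at t within I)" for v
    using assms by (metis has_vector_derivative_transform)
  then show ?thesis
    by (simp add: velocity_def vector_derivative_def)
qed

text \<open>In a family closed under differentiation, every iterated velocity agrees on the interval
  with a member, by induction. This settles all orders without computing them.\<close>

lemma smooth_curve_onI:
  fixes W :: "(real \<Rightarrow> 'a::real_normed_vector) set"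
  assumes "a < b" "c \<in> W"
    and closed: "\<And>f. f \<in> W \<Longrightarrow>
      \<exists>f'\<in>W. \<forall>t\<in>{a..b}. (f has_vector_derivative f' t) (at t within {a..b})"
  shows "smooth_curve_on {a..b} c"
proof -
  have "\<exists>f\<in>W. \<forall>t\<in>{a..b}. (velocity {a..b} ^^ n) c t = f t" for n
  proof (induction n)
    case 0
    show ?case using \<open>c \<in> W\<close> by auto
  next
    case (Suc n)
    then obtain f where f: "f \<in> W" "\<And>t. t \<in> {a..b} \<Longrightarrow> (velocity {a..b} ^^ n) c t = f t"
      by blast
    obtain f' where f': "f' \<in> W" "\<And>t. t \<in> {a..b} \<Longrightarrow> (f has_vector_derivative f' t) (at t within {a..b})"
      using closed[OF f(1)] by blast
    have "(velocity {a..b} ^^ Suc n) c t = f' t" if "t \<in> {a..b}" for t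
      using velocity_cong[OF that f(2)] velocity_eqI[OF \<open>a < b\<close> that f'(2)[OF that]] by simp
    then show ?case using f'(1) by blast
  qed
  then have "(velocity {a..b} ^^ n) c differentiable (at t within {a..b})" if t: "t \<in> {a..b}" for n t
  proof -
    obtain f where f: "f \<in> W" "\<And>t. t \<in> {a..b} \<Longrightarrow> (velocity {a..b} ^^ n) c t = f t"
      using \<open>\<And>n. \<exists>f\<in>W. \<forall>t\<in>{a..b}. (velocity {a..b} ^^ n) c t = f t\<close> by blast
    obtain f' where "(f has_vector_derivative f' t) (at t within {a..b})"
      using closed[OF f(1)] t by blast
    from has_vector_derivative_transform[OF t f(2) this] show ?thesis
      by (rule differentiableI_vector)
  qed
  then show ?thesis
    by (simp add: smooth_curve_on_def differentiable_on_def)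
qed

section \<open>The Frenet system: existence, uniqueness and smoothness\<close>

text \<open>The Frenet system of a unit speed curve of signed curvature \<open>k\<close> in the sphere of radius
  \<open>r\<close> for \<open>c = 1 / r\<^sup>2\<close>, and in the plane for \<open>c = 0\<close>.\<close>

definition frenet ::
  "real \<Rightarrow> (real \<Rightarrow> real) \<Rightarrow> real set \<Rightarrow> (real \<Rightarrow> 'a::real_normed_vector) \<Rightarrow> (real \<Rightarrow> 'a) \<Rightarrow> (real \<Rightarrow> 'a) \<Rightarrow> bool"
  where "frenet c k I X T N \<longleftrightarrow> (\<forall>t\<in>I.
    (X has_vector_derivative T t) (at t within I) \<and>
    (T has_vector_derivative - (c *\<^sub>R X t) + k t *\<^sub>R N t) (at t within I) \<and>
    (N has_vector_derivative - (k t *\<^sub>R T t)) (at t within I))"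

lemma frenetD:
  assumes "frenet c k I X T N" "t \<in> I"
  shows "(X has_vector_derivative T t) (at t within I)"
    and "(T has_vector_derivative - (c *\<^sub>R X t) + k t *\<^sub>R N t) (at t within I)"
    and "(N has_vector_derivative - (k t *\<^sub>R T t)) (at t within I)"
  using assms by (auto simp: frenet_def)

text \<open>The system is linear, and \<open>k\<close> is bounded on the compact interval, so the
  right-hand side has a global Lipschitz constant.\<close>

lemma frenet_exists:
  fixes x0 t0 n0 :: "'a::banach"
  assumes k: "continuous_on {a..b} k" and "a \<le> b"
  obtains X T N where "frenet c k {a..b} X T N" "X a = x0" "T a = t0" "N a = n0"
proof -
  define f :: "real \<Rightarrow> 'a \<times> 'a \<times> 'a \<Rightarrow> 'a \<times> 'a \<times> 'a"
    where "f t z = (fst (snd z), - (c *\<^sub>R fst z) + k t *\<^sub>R snd (snd z), - (k t *\<^sub>R fst (snd z)))" for t z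
  have "bounded (k ` {a..b})"
    using k by (intro compact_imp_bounded compact_continuous_image) auto
  then obtain K where K: "\<And>t. t \<in> {a..b} \<Longrightarrow> \<bar>k t\<bar> \<le> K"
    unfolding bounded_iff by (metis imageI real_norm_def)
  then have "K \<ge> 0"
    using \<open>a \<le> b\<close> by (meson abs_ge_zero atLeastAtMost_iff order_refl order_trans)
  have cont: "continuous_on ({a..b} \<times> UNIV) (\<lambda>(t, z). f t z)"
  proof -
    have "continuous_on ({a..b} \<times> UNIV) (\<lambda>z::real \<times> 'a \<times> 'a \<times> 'a. k (fst z))"
      by (rule continuous_on_compose2[OF k]) (auto intro: continuous_intros)
    then show ?thesis
      unfolding f_def case_prod_beta by (intro continuous_intros)
  qed
  have lip: "norm (f t x - f t y) \<le> (1 + \<bar>c\<bar> + 2 * K) * norm (x - y)" if "t \<in> {a..b}" for t x y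
  proof -
    obtain u v w where z: "x - y = (u, v, w)" by (metis prod_cases3)
    have "f t x - f t y = f t (x - y)"
      by (simp add: f_def algebra_simps)
    also have "norm \<dots> \<le> norm v + norm (- (c *\<^sub>R u) + k t *\<^sub>R w) + norm (- (k t *\<^sub>R v))"
      using norm_Pair_le[of v "(- (c *\<^sub>R u) + k t *\<^sub>R w, - (k t *\<^sub>R v))"]
        norm_Pair_le[of "- (c *\<^sub>R u) + k t *\<^sub>R w" "- (k t *\<^sub>R v)"]
      unfolding f_def z fst_conv snd_conv by linarith
    also have "\<dots> \<le> norm v + (\<bar>c\<bar> * norm u + \<bar>k t\<bar> * norm w) + \<bar>k t\<bar> * norm v"
      by (intro add_mono norm_triangle_le) auto
    also have "\<dots> \<le> norm (x - y) + (\<bar>c\<bar> * norm (x - y) + K * norm (x - y)) + K * norm (x - y)"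
    proof -
      have "norm (v, w) \<le> norm (x - y)" "norm u \<le> norm (x - y)"
        unfolding z by (metis norm_snd_le norm_fst_le)+
      moreover have "norm v \<le> norm (v, w)" "norm w \<le> norm (v, w)"
        by (metis norm_snd_le norm_fst_le)+
      ultimately show ?thesis
        using K[OF that] \<open>K \<ge> 0\<close> by (intro add_mono mult_mono) auto
    qed
    finally show ?thesis by (simp add: algebra_simps)
  qed
  have pos: "1 + \<bar>c\<bar> + 2 * K > 0"
    using \<open>K \<ge> 0\<close> by linarith
  obtain z where z: "z a = (x0, t0, n0)"
    and dz: "\<And>t. t \<in> {a..b} \<Longrightarrow> (z has_vector_derivative f t (z t)) (at t within {a..b})"
    using global_lipschitz_ivp[OF cont lip \<open>a \<le> b\<close> pos, of "(x0, t0, n0)"] by blast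
  note fst_deriv = bounded_linear.has_vector_derivative[OF bounded_linear_fst]
  note snd_deriv = bounded_linear.has_vector_derivative[OF bounded_linear_snd]
  have "frenet c k {a..b} (\<lambda>t. fst (z t)) (\<lambda>t. fst (snd (z t))) (\<lambda>t. snd (snd (z t)))"
    unfolding frenet_def
    using fst_deriv[OF dz] fst_deriv[OF snd_deriv[OF dz]] snd_deriv[OF snd_deriv[OF dz]]
    by (simp add: f_def)
  then show thesis
    using that z by simp
qed

lemma has_vector_derivative_inner:
  fixes f g :: "real \<Rightarrow> 'a::real_inner"
  assumes "(f has_vector_derivative f') (at t within I)" "(g has_vector_derivative g') (at t within I)"
  shows "((\<lambda>t. f t \<bullet> g t) has_real_derivative (f t \<bullet> g' + f' \<bullet> g t)) (at t within I)"
  using bounded_bilinear.has_vector_derivative[OF bounded_bilinear_inner assms]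
  by (simp add: has_real_derivative_iff_has_vector_derivative)

text \<open>The system is skew for the inner product that scales the first slot by \<open>c\<close>, so solutions
  conserve the corresponding energy.\<close>

lemma frenet_unique:
  fixes X X' :: "real \<Rightarrow> 'a::real_inner"
  assumes F: "frenet c k I X T N" and F': "frenet c k I X' T' N'"
    and "convex I" "c > 0" "t0 \<in> I" "X t0 = X' t0" "T t0 = T' t0" "N t0 = N' t0" "t \<in> I"
  shows "X t = X' t \<and> T t = T' t \<and> N t = N' t"
proof -
  define E where "E t = c * ((X t - X' t) \<bullet> (X t - X' t)) + (T t - T' t) \<bullet> (T t - T' t)
    + (N t - N' t) \<bullet> (N t - N' t)" for t
  have "(E has_real_derivative 0) (at s within I)" if "s \<in> I" for s
    unfolding E_def[abs_def]
    by (rule derivative_eq_intros has_vector_derivative_inner has_vector_derivative_diff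
        frenetD[OF F that] frenetD[OF F' that] refl)+
      (simp add: inner_commute algebra_simps)
  then obtain e where "\<And>s. s \<in> I \<Longrightarrow> E s = e"
    using has_field_derivative_zero_constant[OF \<open>convex I\<close>] by metis
  then have "E t = E t0"
    using assms by simp
  then have "c * ((X t - X' t) \<bullet> (X t - X' t)) + (T t - T' t) \<bullet> (T t - T' t)
    + (N t - N' t) \<bullet> (N t - N' t) = 0"
    using assms by (simp add: E_def)
  moreover have "c * ((X t - X' t) \<bullet> (X t - X' t)) \<ge> 0" "(T t - T' t) \<bullet> (T t - T' t) \<ge> 0"
      "(N t - N' t) \<bullet> (N t - N' t) \<ge> 0"
    using \<open>c > 0\<close> by auto
  ultimately have "c * ((X t - X' t) \<bullet> (X t - X' t)) = 0" "(T t - T' t) \<bullet> (T t - T' t) = 0"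
      "(N t - N' t) \<bullet> (N t - N' t) = 0"
    by linarith+
  then show ?thesis
    using \<open>c > 0\<close> by simp
qed

text \<open>Combinations of \<open>B\<close> with trigonometric polynomials as coefficients.
  Multiplication by cos is what the curvature \<open>2 - cos t\<close> brings in, and sin comes from
  differentiating cos.\<close>

inductive_set frenet_span :: "(real \<Rightarrow> 'a::real_vector) set \<Rightarrow> (real \<Rightarrow> 'a) set" for B where
  base: "f \<in> B \<Longrightarrow> f \<in> frenet_span B"
| add: "f \<in> frenet_span B \<Longrightarrow> g \<in> frenet_span B \<Longrightarrow> (\<lambda>t. f t + g t) \<in> frenet_span B"
| scale: "f \<in> frenet_span B \<Longrightarrow> (\<lambda>t. a *\<^sub>R f t) \<in> frenet_span B"
| cos: "f \<in> frenet_span B \<Longrightarrow> (\<lambda>t. cos t *\<^sub>R f t) \<in> frenet_span B"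
| sin: "f \<in> frenet_span B \<Longrightarrow> (\<lambda>t. sin t *\<^sub>R f t) \<in> frenet_span B"

text \<open>The Frenet equations and the product rule both stay inside the span of the frame with
  trigonometric coefficients, so that this span is closed under differentiation.\<close>

lemma frenet_smooth:
  fixes X :: "real \<Rightarrow> 'a::real_normed_vector"
  assumes F: "frenet c (\<lambda>t. 2 - cos t) {a..b} X T N" and "a < b"
  shows "smooth_curve_on {a..b} X"
proof (rule smooth_curve_onI[OF \<open>a < b\<close>])
  let ?W = "frenet_span {X, T, N}"
  show "X \<in> ?W" by (auto intro: frenet_span.base)
  have W: "X \<in> ?W" "T \<in> ?W" "N \<in> ?W"
    by (auto intro: frenet_span.base)
  fix f assume "f \<in> ?W"
  then show "\<exists>f'\<in>?W. \<forall>t\<in>{a..b}. (f has_vector_derivative f' t) (at t within {a..b})"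
  proof induction
    case (base f)
    then consider "f = X" | "f = T" | "f = N"
      by blast
    then show ?case
    proof cases
      case 1
      then show ?thesis
        using frenetD(1)[OF F] W by blast
    next
      case 2
      have "(\<lambda>t. (- c) *\<^sub>R X t + (2 *\<^sub>R N t + (-1) *\<^sub>R (cos t *\<^sub>R N t))) \<in> ?W"
        by (intro frenet_span.add frenet_span.scale frenet_span.cos W)
      then show ?thesis
        by (rule bexI[rotated]) (use 2 frenetD(2)[OF F] in \<open>auto simp: algebra_simps\<close>)
    next
      case 3
      have "(\<lambda>t. (-2) *\<^sub>R T t + cos t *\<^sub>R T t) \<in> ?W"
        by (intro frenet_span.add frenet_span.scale frenet_span.cos W)
      then show ?thesis
        by (rule bexI[rotated]) (use 3 frenetD(3)[OF F] in \<open>auto simp: algebra_simps\<close>)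
    qed
  next
    case (add f g)
    then obtain f' g' where "f' \<in> ?W" "g' \<in> ?W"
      "\<And>t. t \<in> {a..b} \<Longrightarrow> (f has_vector_derivative f' t) (at t within {a..b})"
      "\<And>t. t \<in> {a..b} \<Longrightarrow> (g has_vector_derivative g' t) (at t within {a..b})"
      by blast
    then show ?case
      by (intro bexI[of _ "\<lambda>t. f' t + g' t"] ballI has_vector_derivative_add frenet_span.add)
  next
    case (scale f d)
    then obtain f' where "f' \<in> ?W"
      "\<And>t. t \<in> {a..b} \<Longrightarrow> (f has_vector_derivative f' t) (at t within {a..b})"
      by blast
    then show ?case
      by (intro bexI[of _ "\<lambda>t. d *\<^sub>R f' t"] frenet_span.scale)
        (auto intro!: derivative_eq_intros)
  next
    case (cos f)
    then obtain f' where f': "f' \<in> ?W"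
      "\<And>t. t \<in> {a..b} \<Longrightarrow> (f has_vector_derivative f' t) (at t within {a..b})"
      by blast
    have "(\<lambda>t. cos t *\<^sub>R f' t + (-1) *\<^sub>R (sin t *\<^sub>R f t)) \<in> ?W"
      by (intro frenet_span.intros f' cos)
    then show ?case
      by (rule bexI[rotated]) (auto intro!: derivative_eq_intros f')
  next
    case (sin f)
    then obtain f' where f': "f' \<in> ?W"
      "\<And>t. t \<in> {a..b} \<Longrightarrow> (f has_vector_derivative f' t) (at t within {a..b})"
      by blast
    have "(\<lambda>t. sin t *\<^sub>R f' t + cos t *\<^sub>R f t) \<in> ?W"
      by (intro frenet_span.intros f' sin)
    then show ?case
      by (rule bexI[rotated]) (auto intro!: derivative_eq_intros f')
  qed
qed

section \<open>The first return to the plane of symmetry\<close>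

text \<open>Here \<open>y\<close>, \<open>p\<close>, \<open>q\<close> stand for the components of
  position, tangent and conormal along the tangent at \<pi>. As \<open>q + k * y\<close> has
  derivative \<open>k' * y\<close>, it decreases from 0 while \<open>y\<close> is positive. This
  bounds the derivative of \<open>p\<close> by \<open>- y\<close>, which forces \<open>y\<close> to
  vanish in time, and it makes \<open>q\<close> negative at the first zero.\<close>

lemma first_return_oblique:
  fixes y p q k :: "real \<Rightarrow> real"
  assumes dy: "\<And>t. t \<in> {pi..2*pi} \<Longrightarrow> (y has_real_derivative p t) (at t within {pi..2*pi})"
    and dp: "\<And>t. t \<in> {pi..2*pi} \<Longrightarrow>
      (p has_real_derivative - (c * y t) + k t * q t) (at t within {pi..2*pi})"
    and dq: "\<And>t. t \<in> {pi..2*pi} \<Longrightarrow> (q has_real_derivative - (k t * p t)) (at t within {pi..2*pi})"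
    and dk: "\<And>t. t \<in> {pi..2*pi} \<Longrightarrow> (k has_real_derivative k' t) (at t within {pi..2*pi})"
    and k'_neg: "\<And>t. pi < t \<Longrightarrow> t < 2*pi \<Longrightarrow> k' t < 0"
    and k_ge: "\<And>t. t \<in> {pi..2*pi} \<Longrightarrow> k t \<ge> 1"
    and "c \<ge> 0"
    and init: "y pi = 0" "p pi = 1" "q pi = 0"
  obtains t where "pi < t" "t \<le> 2*pi" "y t = 0" "p t < 0" "q t < 0"
proof -
  have at: "at t within {pi..2*pi} = at t" if "pi < t" "t < 2*pi" for t
    using that by (intro at_within_interior) auto
  have cont: "continuous_on {pi..2*pi} f" 
    if "\<And>t. t \<in> {pi..2*pi} \<Longrightarrow> (f has_real_derivative f' t) (at t within {pi..2*pi})" for f f'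
    using that by (meson DERIV_continuous_on)
  note conts = cont[OF dy] cont[OF dp] cont[OF dq] cont[OF dk]
  have dqky: "((\<lambda>t. q t + k t * y t) has_real_derivative k' t * y t) (at t)" if "pi < t" "t < 2*pi" for t
    using that dq[of t] dk[of t] dy[of t] by (auto simp: at intro!: derivative_eq_intros)
  have qky: "continuous_on {pi..2*pi} (\<lambda>t. q t + k t * y t)"
    by (intro continuous_intros conts)
  obtain d where d: "d > 0" "\<And>h. h > 0 \<Longrightarrow> pi + h \<in> {pi..2*pi} \<Longrightarrow> h < d \<Longrightarrow> y pi < y (pi + h)"
    using has_real_derivative_pos_inc_right[OF dy[of pi]] init by auto
  \<comment> \<open>The zero of \<open>y\<close> at \<pi> itself must be kept out of the search for
    the first return, which therefore starts at \<open>e\<close>.\<close>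
  define e where "e = pi + min d pi / 2"
  have e: "pi < e" "e < 2*pi" "e < pi + d"
    using d(1) by (auto simp: e_def min_def field_simps)
  have y_pos: "y t > 0" if "pi < t" "t \<le> e" for t
    using d(2)[of "t - pi"] that e init by auto
  have q_le: "q t + k t * y t \<le> 0" 
    if "pi < t" "t \<le> 2*pi" and pos: "\<And>s. pi < s \<Longrightarrow> s < t \<Longrightarrow> y s > 0" for t
  proof -
    have "q t + k t * y t \<le> q pi + k pi * y pi"
    proof (rule DERIV_nonpos_imp_decreasing_open[where f = "\<lambda>t. q t + k t * y t"])
      show "\<exists>z. ((\<lambda>t. q t + k t * y t) has_real_derivative z) (at s) \<and> z \<le> 0" if "pi < s" "s < t" for s
        using that \<open>t \<le> 2*pi\<close> dqky[of s] k'_neg[of s] pos[of s]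
        by (intro exI[of _ "k' s * y s"]) (auto intro: mult_nonpos_nonneg less_imp_le)
    qed (use that in \<open>auto intro: continuous_on_subset[OF qky]\<close>)
    then show ?thesis by (simp add: init)
  qed
  have "\<exists>z\<in>{e..2*pi}. y z \<le> 0"
  proof (rule ccontr)
    assume "\<not> ?thesis"
    then have pos: "y t > 0" if "pi < t" "t \<le> 2*pi" for t
      using that y_pos[of t] by (cases "t \<le> e") (auto simp: not_le)
    \<comment> \<open>Sturm comparison with \<open>sin\<close>: the Wronskian is monotone because \<open>p' + y \<le> 0\<close>.\<close>
    define w where "w t = y t * cos t - p t * sin t" for t
    have "w (2*pi) \<le> w pi"
    proof (rule DERIV_nonpos_imp_decreasing_open[where f = w])
      show "continuous_on {pi..2*pi} w"
        unfolding w_def[abs_def] by (intro continuous_intros conts)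
      fix t assume t: "pi < t" "t < 2*pi"
      have "(w has_real_derivative - ((- (c * y t) + k t * q t + y t) * sin t)) (at t)"
        unfolding w_def[abs_def] using t dy[of t] dp[of t] at[of t]
        by (auto intro!: derivative_eq_intros simp: algebra_simps)
      moreover have "- ((- (c * y t) + k t * q t + y t) * sin t) \<le> 0"
      proof -
        have k: "k t \<ge> 1" using k_ge t by auto
        \<comment> \<open>Combined, these estimates give
          \<open>k t * q t \<le> - (k t * k t * y t) \<le> - y t\<close>.\<close>
        have "k t * (q t + k t * y t) \<le> 0"
          using q_le[of t] pos t k by (intro mult_nonneg_nonpos) auto
        moreover have "1 * 1 * y t \<le> k t * k t * y t"
          using k pos[of t] t by (intro mult_mono) auto
        moreover have "c * y t \<ge> 0"
          using \<open>c \<ge> 0\<close> pos[of t] t by auto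
        ultimately have "- (c * y t) + k t * q t + y t \<le> 0"
          by (simp add: algebra_simps)
        moreover have "sin t < 0"
          using t by (intro sin_lt_zero) auto
        ultimately have "0 \<le> (- (c * y t) + k t * q t + y t) * sin t"
          by (intro mult_nonpos_nonpos) auto
        then show ?thesis by linarith
      qed
      ultimately show "\<exists>z. (w has_real_derivative z) (at t) \<and> z \<le> 0"
        by blast
    qed simp
    \<comment> \<open>The Wronskian is 0 at \<pi> and equals \<open>y\<close> at
      \<open>2*pi\<close>, so its monotonicity contradicts positivity there.\<close>
    then show False
      using pos[of "2*pi"] init by (simp add: w_def)
  qed
  then have ne: "{t \<in> {e..2*pi}. y t \<le> 0} \<noteq> {}" by auto
  have ye: "continuous_on {e..2*pi} y"
    using e by (intro continuous_on_subset[OF conts(1)]) auto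
  have "closed {t \<in> {e..2*pi}. y t \<le> 0}"
    using continuous_on_closed_Collect_le[OF ye, of "\<lambda>_. 0"] by auto
  then have "compact {t \<in> {e..2*pi}. y t \<le> 0}"
    unfolding compact_eq_bounded_closed by (auto intro: bounded_subset[OF bounded_closed_interval[of e "2*pi"]])
  \<comment> \<open>The first return is the least point where \<open>y\<close> is not positive; the
    intermediate value theorem then makes \<open>y\<close> vanish there.\<close>
  from continuous_attains_inf[OF this ne continuous_on_id]
  obtain z where z: "z \<in> {e..2*pi}" "y z \<le> 0" "\<And>t. t \<in> {e..2*pi} \<Longrightarrow> y t \<le> 0 \<Longrightarrow> z \<le> t"
    by auto
  have "\<exists>x. e \<le> x \<and> x \<le> z \<and> y x = 0"
    using z y_pos[of e] e by (intro IVT2') (auto intro: continuous_on_subset[OF ye])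
  then have yz: "y z = 0"
    using z by force
  have pi_z: "pi < z" "z \<le> 2*pi" using z e by auto
  have pos: "y t > 0" if "pi < t" "t < z" for t
  proof (cases "t \<le> e")
    case False
    then have "\<not> y t \<le> 0"
      using that z(1) z(3)[of t] by auto
    then show ?thesis by simp
  qed (use that y_pos in auto)
  have "q z + k z * y z < q pi + k pi * y pi"
  proof (rule DERIV_neg_imp_decreasing_open[where f = "\<lambda>t. q t + k t * y t"])
    show "\<exists>x. ((\<lambda>t. q t + k t * y t) has_real_derivative x) (at s) \<and> x < 0" if "pi < s" "s < z" for s
      using that pi_z dqky[of s] k'_neg[of s] pos[of s]
      by (intro exI[of _ "k' s * y s"]) (auto intro: mult_neg_pos)
  qed (use pi_z in \<open>auto intro: continuous_on_subset[OF qky]\<close>)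
  then have qz: "q z < 0" by (simp add: yz init)
  \<comment> \<open>At \<open>z\<close> the derivative of \<open>p\<close> is
    \<open>k z * q z\<close>, which is negative. If \<open>p z\<close> were nonnegative,
    \<open>p\<close> would be positive just before \<open>z\<close>, and \<open>y\<close> would
    increase to 0 there, against its positivity.\<close>
  have "p z < 0"
  proof (rule ccontr)
    assume "\<not> p z < 0"
    have "k z * q z < 0"
      using k_ge[of z] pi_z qz by (intro mult_pos_neg) auto
    then obtain \<delta> where \<delta>: "\<delta> > 0"
        "\<And>h. h > 0 \<Longrightarrow> z - h \<in> {pi..2*pi} \<Longrightarrow> h < \<delta> \<Longrightarrow> p z < p (z - h)"
      using has_real_derivative_neg_dec_left[OF dp[of z]] pi_z yz by auto
    define a where "a = z - min \<delta> (z - pi) / 2"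
    have a: "pi < a" "a < z" "z - \<delta> < a"
      using \<delta>(1) pi_z by (auto simp: a_def min_def field_simps)
    have "y a < y z"
    proof (rule DERIV_pos_imp_increasing_open[where f = y])
      show "\<exists>x. (y has_real_derivative x) (at s) \<and> 0 < x" if "a < s" "s < z" for s
        using that a pi_z dy[of s] at[of s] \<delta>(2)[of "z - s"] \<open>\<not> p z < 0\<close>
        by (intro exI[of _ "p s"]) auto
    qed (use a pi_z in \<open>auto intro: continuous_on_subset[OF conts(1)]\<close>)
    then show False
      using pos[of a] a yz by simp
  qed
  with that[OF pi_z yz _ qz] show thesis by blast
qed

section \<open>Symmetries of the Frenet system\<close>

lemma frenet_linear_image:
  assumes "bounded_linear f" "frenet c k I X T N"
  shows "frenet c k I (\<lambda>t. f (X t)) (\<lambda>t. f (T t)) (\<lambda>t. f (N t))"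
proof -
  interpret bounded_linear f by fact
  show ?thesis
    using frenetD[OF assms(2), THEN has_vector_derivative]
    by (auto simp: frenet_def add neg scaleR diff)
qed

text \<open>Reversing time negates derivatives. In the first and third equation the new sign of the
  tangent absorbs this; in the second the two signs cancel.\<close>

lemma frenet_reverse:
  fixes X :: "real \<Rightarrow> 'a::real_normed_vector"
  assumes F: "frenet c k {0..b} X T N" and k: "\<And>t. t \<in> {0..b} \<Longrightarrow> k (b - t) = k t"
  shows "frenet c k {0..b} (\<lambda>t. X (b - t)) (\<lambda>t. - T (b - t)) (\<lambda>t. N (b - t))"
proof -
  have rev: "((\<lambda>t. f (b - t)) has_vector_derivative - f') (at t within {0..b})"
    if "(f has_vector_derivative f') (at (b - t) within {0..b})" for f :: "real \<Rightarrow> 'a" and f' t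
  proof -
    have "((\<lambda>t. b - t) has_vector_derivative -1) (at t within {0..b})"
      by (auto intro!: derivative_eq_intros)
    moreover have "(f has_vector_derivative f') (at (b - t) within (\<lambda>t. b - t) ` {0..b})"
      using that by simp
    ultimately show ?thesis
      using vector_diff_chain_within by (fastforce simp: o_def)
  qed
  have "b - t \<in> {0..b}" if "t \<in> {0..b}" for t
    using that by auto
  note F = frenetD[OF F this]
  show ?thesis
    unfolding frenet_def using rev[OF F(1)] has_vector_derivative_minus[OF rev[OF F(2)]] rev[OF F(3)]
    by (auto simp: k)
qed

section \<open>Frenet frames on the sphere\<close>

lemma has_vector_derivative_cross3:
  assumes "(f has_vector_derivative f') (at t within I)" "(g has_vector_derivative g') (at t within I)"
  shows "((\<lambda>t. cross3 (f t) (g t)) has_vector_derivative (cross3 (f t) g' + cross3 f' (g t))) (at t within I)"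
  using bounded_bilinear.has_vector_derivative[OF bilinear_cross[unfolded bilinear_conv_bounded_bilinear] assms] .

text \<open>The frame relations hold at the start and propagate along the system. Thus a solution is
  a unit speed curve on the sphere whose third component is the conormal, which is what the
  existence of liftings requires.\<close>

lemma frenet_orthonormal:
  fixes X :: "real \<Rightarrow> real^3"
  assumes F: "frenet (1 / r\<^sup>2) k {a..b} X T N" and "r > 0" "a < b"
    and init: "X a = vector [r, 0, 0]" "T a = vector [0, 1, 0]" "N a = vector [0, 0, 1]"
    and t: "t \<in> {a..b}"
  shows "X t \<bullet> X t = r\<^sup>2" "T t \<bullet> T t = 1" "X t \<bullet> N t = 0" "N t \<bullet> N t = 1"
    "cross3 (X t /\<^sub>R r) (T t) = N t"
proof -
  define c where "c = 1 / r\<^sup>2"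
  have c: "c * r\<^sup>2 = 1" "c > 0"
    using \<open>r > 0\<close> by (auto simp: c_def)
  note F = frenetD[OF F[folded c_def]]
  have const: "f t = f a" if "\<And>s. s \<in> {a..b} \<Longrightarrow> (f has_real_derivative 0) (at s within {a..b})" for f
    using has_field_derivative_zero_constant[OF convex_closed_interval that] t by fastforce
  \<comment> \<open>The squared distance of the Gram matrix of the frame from the identity is conserved.\<close>
  define E where "E s = c\<^sup>2 * (X s \<bullet> X s - r\<^sup>2)\<^sup>2 + (T s \<bullet> T s - 1)\<^sup>2 + (N s \<bullet> N s - 1)\<^sup>2
    + 2 * c * (X s \<bullet> T s)\<^sup>2 + 2 * c * (X s \<bullet> N s)\<^sup>2 + 2 * (T s \<bullet> N s)\<^sup>2" for s
  have "(E has_real_derivative 0) (at s within {a..b})" if s: "s \<in> {a..b}" for s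
  proof -
    define XX XT XN TT TN NN where
      "XX = X s \<bullet> X s" and "XT = X s \<bullet> T s" and "XN = X s \<bullet> N s" and "TT = T s \<bullet> T s" and
      "TN = T s \<bullet> N s" and "NN = N s \<bullet> N s"
    have dXX: "((\<lambda>s. X s \<bullet> X s) has_real_derivative 2 * XT) (at s within {a..b})"
      using has_vector_derivative_inner[OF F(1) F(1), OF s s] by (simp add: inner_commute XT_def)
    have dTT: "((\<lambda>s. T s \<bullet> T s) has_real_derivative 2 * (k s * TN - c * XT)) (at s within {a..b})"
      using has_vector_derivative_inner[OF F(2) F(2), OF s s]
      by (simp add: inner_commute XT_def TN_def algebra_simps)
    have dNN: "((\<lambda>s. N s \<bullet> N s) has_real_derivative - 2 * k s * TN) (at s within {a..b})"
      using has_vector_derivative_inner[OF F(3) F(3), OF s s]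
      by (simp add: inner_commute TN_def algebra_simps)
    have dXT: "((\<lambda>s. X s \<bullet> T s) has_real_derivative TT - c * XX + k s * XN) (at s within {a..b})"
      using has_vector_derivative_inner[OF F(1) F(2), OF s s]
      by (simp add: inner_commute TT_def XX_def XN_def algebra_simps)
    have dXN: "((\<lambda>s. X s \<bullet> N s) has_real_derivative TN - k s * XT) (at s within {a..b})"
      using has_vector_derivative_inner[OF F(1) F(3), OF s s]
      by (simp add: inner_commute TN_def XT_def algebra_simps)
    have dTN: "((\<lambda>s. T s \<bullet> N s) has_real_derivative - c * XN + k s * NN - k s * TT) (at s within {a..b})"
      using has_vector_derivative_inner[OF F(2) F(3), OF s s]
      by (simp add: inner_commute TT_def NN_def XN_def algebra_simps)
    have "(E has_real_derivative
        c\<^sup>2 * (2 * (XX - r\<^sup>2) * (2 * XT)) + 2 * (TT - 1) * (2 * (k s * TN - c * XT))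
        + 2 * (NN - 1) * (- 2 * k s * TN) + 2 * c * (2 * XT * (TT - c * XX + k s * XN))
        + 2 * c * (2 * XN * (TN - k s * XT)) + 2 * (2 * TN * (- c * XN + k s * NN - k s * TT)))
        (at s within {a..b})"
      unfolding E_def[abs_def]
      by (rule derivative_eq_intros dXX dTT dNN dXT dXN dTN refl)+
        (simp add: XX_def XT_def XN_def TT_def TN_def NN_def algebra_simps)
    also have "c\<^sup>2 * (2 * (XX - r\<^sup>2) * (2 * XT)) + 2 * (TT - 1) * (2 * (k s * TN - c * XT))
        + 2 * (NN - 1) * (- 2 * k s * TN) + 2 * c * (2 * XT * (TT - c * XX + k s * XN))
        + 2 * c * (2 * XN * (TN - k s * XT)) + 2 * (2 * TN * (- c * XN + k s * NN - k s * TT)) = 0"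
      using c(1) by algebra
    finally show ?thesis .
  qed
  then have "E t = E a" by (rule const)
  also have "E a = 0"
    by (simp add: E_def init inner_vec_def sum_3 power2_eq_square)
  finally have E0: "E t = 0" .
  have "c\<^sup>2 * (X t \<bullet> X t - r\<^sup>2)\<^sup>2 \<ge> 0" "(T t \<bullet> T t - 1)\<^sup>2 \<ge> 0" "(N t \<bullet> N t - 1)\<^sup>2 \<ge> 0"
    "2 * c * (X t \<bullet> T t)\<^sup>2 \<ge> 0" "2 * c * (X t \<bullet> N t)\<^sup>2 \<ge> 0" "2 * (T t \<bullet> N t)\<^sup>2 \<ge> 0"
    using c(2) by auto
  then have "c\<^sup>2 * (X t \<bullet> X t - r\<^sup>2)\<^sup>2 = 0" "(T t \<bullet> T t - 1)\<^sup>2 = 0" "(N t \<bullet> N t - 1)\<^sup>2 = 0"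
    "2 * c * (X t \<bullet> T t)\<^sup>2 = 0" "2 * c * (X t \<bullet> N t)\<^sup>2 = 0"
    using E0 unfolding E_def by linarith+
  then show XX: "X t \<bullet> X t = r\<^sup>2" and TT: "T t \<bullet> T t = 1" and XN: "X t \<bullet> N t = 0"
      and NN: "N t \<bullet> N t = 1"
    using c(2) by auto
  have XT: "X t \<bullet> T t = 0"
    using c(2) \<open>2 * c * (X t \<bullet> T t)\<^sup>2 = 0\<close> by auto
  \<comment> \<open>The Gram matrix leaves the sign of \<open>N\<close> open; this conserved triple
    product fixes it.\<close>
  have "((\<lambda>s. cross3 (X s) (T s) \<bullet> N s) has_real_derivative 0) (at s within {a..b})"
    if s: "s \<in> {a..b}" for s
    using has_vector_derivative_inner[OF has_vector_derivative_cross3[OF F(1) F(2)] F(3), OF s s s]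
    by (simp add: Cross3.right_diff_distrib cross_mult_right dot_cross_self inner_diff_left)
  then have "cross3 (X t) (T t) \<bullet> N t = cross3 (X a) (T a) \<bullet> N a"
    by (rule const)
  also have "\<dots> = r"
    by (simp add: init cross3_def inner_vec_def sum_3)
  finally have triple: "cross3 (X t) (T t) \<bullet> N t = r" .
  have "norm (X t) = r" "norm (T t) = 1"
    using XX TT \<open>r > 0\<close> by (simp_all add: norm_eq_sqrt_inner)
  then have cross: "cross3 (X t) (T t) \<bullet> cross3 (X t) (T t) = r\<^sup>2"
    using norm_cross_dot[of "X t" "T t"] XT by (simp flip: power2_norm_eq_inner)
  have "(cross3 (X t) (T t) - r *\<^sub>R N t) \<bullet> (cross3 (X t) (T t) - r *\<^sub>R N t) = 0"
    using cross triple NN by (simp add: inner_diff inner_commute power2_eq_square algebra_simps)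
  then have "cross3 (X t) (T t) = r *\<^sub>R N t"
    by simp
  then show "cross3 (X t /\<^sub>R r) (T t) = N t"
    using \<open>r > 0\<close> by (simp add: cross_mult_left)
qed

text \<open>The remainder \<open>d\<close> is orthogonal to \<open>u\<close> and \<open>v\<close>,
  so its cross product with \<open>cross3 u v\<close> vanishes. Its inner product with that unit
  vector vanishes too, which leaves only 0.\<close>

lemma orthonormal_expansion:
  fixes u v w :: "real^3"
  assumes "u \<bullet> u = 1" "v \<bullet> v = 1" "u \<bullet> v = 0"
  shows "w = (w \<bullet> u) *\<^sub>R u + (w \<bullet> v) *\<^sub>R v + (w \<bullet> cross3 u v) *\<^sub>R cross3 u v"
proof -
  define d where "d = w - (w \<bullet> u) *\<^sub>R u - (w \<bullet> v) *\<^sub>R v - (w \<bullet> cross3 u v) *\<^sub>R cross3 u v"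
  have "norm u = 1" "norm v = 1"
    using assms by (simp_all add: norm_eq_sqrt_inner)
  then have n: "cross3 u v \<bullet> cross3 u v = 1"
    using norm_cross_dot[of u v] assms by (simp flip: power2_norm_eq_inner)
  have d: "d \<bullet> u = 0" "d \<bullet> v = 0" "d \<bullet> cross3 u v = 0"
    using assms n by (auto simp: d_def inner_diff_left dot_cross_self inner_commute[of v u])
  have "cross3 d (cross3 u v) = (d \<bullet> v) *\<^sub>R u - (d \<bullet> u) *\<^sub>R v"
    by (simp add: cross3_simps forall_3)
  then have "cross3 d (cross3 u v) = 0"
    using d by simp
  then have "d = 0"
    using d(3) n norm_and_cross_eq_0[of d "cross3 u v"] by auto
  then show ?thesis
    by (simp add: d_def algebra_simps)
qed

text \<open>Differentiating the relations for radius, speed and orthogonality gives the components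
  of the acceleration along \<open>L\<close> and \<open>V\<close>; the prescribed curvature gives
  the one along \<open>N\<close>. Uniqueness for the Frenet system thereby becomes available for
  every lifting.\<close>

lemma unit_speed_sphere_frenet:
  fixes L :: "real \<Rightarrow> real^3"
  assumes "a < b" "r > 0" and smooth: "smooth_curve_on {a..b} L"
    and sphere: "L ` {a..b} \<subseteq> sphere 0 r"
    and speed: "\<And>t. t \<in> {a..b} \<Longrightarrow> norm (velocity {a..b} L t) = 1"
    and curv: "\<And>t. t \<in> {a..b} \<Longrightarrow> sphere_curvature r {a..b} L t = k t"
  defines "V \<equiv> velocity {a..b} L"
  defines "N \<equiv> \<lambda>t. cross3 (L t /\<^sub>R r) (V t)"
  shows "frenet (1 / r\<^sup>2) k {a..b} L V N" "\<And>t. t \<in> {a..b} \<Longrightarrow> L t \<bullet> V t = 0"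
proof -
  define A where "A = velocity {a..b} V"
  have "L differentiable_on {a..b}" "V differentiable_on {a..b}"
    using smooth[unfolded smooth_curve_on_def, rule_format, of 0]
      smooth[unfolded smooth_curve_on_def, rule_format, of 1] by (simp_all add: V_def)
  then have dL: "(L has_vector_derivative V t) (at t within {a..b})"
    and dV: "(V has_vector_derivative A t) (at t within {a..b})" if "t \<in> {a..b}" for t
    using that by (simp_all add: differentiable_on_def vector_derivative_works V_def A_def velocity_def)
  have zero: "d = 0"
    if t: "t \<in> {a..b}" and "(f has_real_derivative d) (at t within {a..b})"
      and f: "\<And>s. s \<in> {a..b} \<Longrightarrow> f s = e" for f :: "real \<Rightarrow> real" and d e t
  proof -
    have "velocity {a..b} f t = d"
      using that by (intro velocity_eqI \<open>a < b\<close>) (simp_all add: has_real_derivative_iff_has_vector_derivative)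
    moreover have "velocity {a..b} (\<lambda>_. e) t = 0"
      using t by (intro velocity_eqI \<open>a < b\<close>) auto
    ultimately show ?thesis
      using velocity_cong[OF t f] by simp
  qed
  have LL: "L t \<bullet> L t = r\<^sup>2" if "t \<in> {a..b}" for t
    using sphere that by (simp add: image_subset_iff flip: power2_norm_eq_inner)
  have VV: "V t \<bullet> V t = 1" if "t \<in> {a..b}" for t
    using speed[OF that] by (simp flip: power2_norm_eq_inner add: V_def)
  show LV: "L t \<bullet> V t = 0" if t: "t \<in> {a..b}" for t
    using zero[OF t has_vector_derivative_inner[OF dL dL, OF t t] LL] by (simp add: inner_commute)
  have VA: "V t \<bullet> A t = 0" if t: "t \<in> {a..b}" for t
    using zero[OF t has_vector_derivative_inner[OF dV dV, OF t t] VV] by (simp add: inner_commute)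
  have LA: "L t \<bullet> A t = -1" if t: "t \<in> {a..b}" for t
    using zero[OF t has_vector_derivative_inner[OF dL dV, OF t t] LV] VV[OF t] by simp
  have NA: "N t \<bullet> A t = k t" if t: "t \<in> {a..b}" for t
    using curv[OF t] speed[OF t] by (simp add: sphere_curvature_def N_def A_def V_def)
  have A: "A t = - ((1 / r\<^sup>2) *\<^sub>R L t) + k t *\<^sub>R N t" if t: "t \<in> {a..b}" for t
  proof -
    have "A t = (A t \<bullet> (L t /\<^sub>R r)) *\<^sub>R (L t /\<^sub>R r) + (A t \<bullet> V t) *\<^sub>R V t + (A t \<bullet> N t) *\<^sub>R N t"
      unfolding N_def using LL[OF t] VV[OF t] LV[OF t] \<open>r > 0\<close>
      by (intro orthonormal_expansion) (auto simp: power2_eq_square field_simps)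
    then show ?thesis
      using LA[OF t] VA[OF t] NA[OF t] by (simp add: inner_commute power2_eq_square divide_inverse)
  qed
  \<comment> \<open>The term with \<open>V\<close> \<times> \<open>V\<close> drops out, and of the
    acceleration only the \<open>N\<close> component survives the product with \<open>L\<close>. The
    double cross product turns \<open>N\<close> into \<open>- V t\<close>.\<close>
  have "(N has_vector_derivative - (k t *\<^sub>R V t)) (at t within {a..b})" if t: "t \<in> {a..b}" for t
  proof -
    have "((\<lambda>t. L t /\<^sub>R r) has_vector_derivative V t /\<^sub>R r) (at t within {a..b})"
      by (rule bounded_linear.has_vector_derivative[OF bounded_linear_scaleR_right dL[OF t]])
    from has_vector_derivative_cross3[OF this dV[OF t]]
    have "(N has_vector_derivative cross3 (L t /\<^sub>R r) (A t)) (at t within {a..b})"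
      by (simp add: N_def[abs_def] cross_mult_left)
    moreover have "cross3 (L t /\<^sub>R r) (N t) = - V t"
    proof -
      have "cross3 (L t) (cross3 (L t) (V t)) = (L t \<bullet> V t) *\<^sub>R L t - (L t \<bullet> L t) *\<^sub>R V t"
        by (simp add: cross3_simps forall_3)
      moreover have "inverse r * (inverse r * (r * r)) = 1"
        using \<open>r > 0\<close> by (simp add: field_simps)
      ultimately show ?thesis
        using LV[OF t] LL[OF t]
        by (simp add: N_def cross_mult_left cross_mult_right power2_eq_square)
    qed
    moreover have "cross3 (L t /\<^sub>R r) (A t) = k t *\<^sub>R cross3 (L t /\<^sub>R r) (N t)"
      by (simp add: A[OF t] Cross3.right_diff_distrib cross_mult_right cross_mult_left)
    ultimately show ?thesis
      by simp
  qed
  then show "frenet (1 / r\<^sup>2) k {a..b} L V N"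
    using dL dV A by (simp add: frenet_def)
qed

section \<open>Transversality and self-intersection\<close>

lemma unit_vectors_independent:
  fixes u v :: "'a::real_inner"
  assumes "norm u = 1" "norm v = 1" "\<bar>u \<bullet> v\<bar> < 1"
  shows "u \<noteq> v \<and> independent {u, v}"
proof -
  have vv: "v \<bullet> v = 1"
    using assms by (simp flip: power2_norm_eq_inner)
  have "u \<notin> span {v}"
  proof
    assume "u \<in> span {v}"
    then obtain a where "u = a *\<^sub>R v"
      by (auto simp: span_singleton)
    then show False
      using assms vv by auto
  qed
  moreover have "u \<noteq> v"
    using assms vv by auto
  moreover have "v \<noteq> 0"
    using assms by auto
  ultimately show ?thesis
    by (simp add: independent_insert)
qed

text \<open>Obliqueness is an open condition on the pair of parameters, so it persists for all pairs
  from small intervals around \<open>s\<close> and \<open>t\<close>, in particular at every meeting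
  of the two arcs.\<close>

lemma transversal_restrictionsI:
  assumes V: "continuous_on {a..b} (velocity {a..b} L)"
    and speed: "\<And>t. t \<in> {a..b} \<Longrightarrow> norm (velocity {a..b} L t) = 1"
    and st: "s \<in> {a..b}" "t \<in> {a..b}" "a < b" "L s = L t"
    and obl: "\<bar>velocity {a..b} L s \<bullet> velocity {a..b} L t\<bar> < 1"
  shows "has_transversal_restrictions {a..b} L"
proof -
  define V where "V = velocity {a..b} L"
  define \<phi> where "\<phi> z = V (fst z) \<bullet> V (snd z)" for z
  have "continuous_on ({a..b} \<times> {a..b}) \<phi>"
    unfolding \<phi>_def[abs_def] V_def
    by (intro continuous_on_inner continuous_on_compose2[OF V] continuous_intros) auto
  moreover have "(s, t) \<in> {a..b} \<times> {a..b}" "1 - \<bar>\<phi> (s, t)\<bar> > 0"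
    using st obl by (auto simp: \<phi>_def V_def)
  ultimately obtain d where d: "d > 0"
    "\<And>z. z \<in> {a..b} \<times> {a..b} \<Longrightarrow> dist z (s, t) < d \<Longrightarrow> dist (\<phi> z) (\<phi> (s, t)) < 1 - \<bar>\<phi> (s, t)\<bar>"
    unfolding continuous_on_iff by metis
  have near: "\<exists>l u. l < u \<and> {l..u} \<subseteq> {a..b} \<and> x \<in> {l..u} \<and> (\<forall>y\<in>{l..u}. dist y x < d/2)"
    if "x \<in> {a..b}" for x
  proof (intro exI conjI ballI)
    \<comment> \<open>Clipping to \<open>{a..b}\<close> keeps the interval nondegenerate even at an
      end point, and \<open>d/3\<close> keeps its closed ends strictly within
      \<open>d/2\<close>.\<close>
    show "max a (x - d/3) < min b (x + d/3)" "x \<in> {max a (x - d/3)..min b (x + d/3)}"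
      using that \<open>d > 0\<close> \<open>a < b\<close> by auto
    show "dist y x < d/2" if "y \<in> {max a (x - d/3)..min b (x + d/3)}" for y
    proof -
      have "x - d/3 \<le> y" "y \<le> x + d/3"
        using that by auto
      then show ?thesis
        using \<open>d > 0\<close> unfolding dist_real_def by linarith
    qed
  qed auto
  obtain l u where lu: "l < u" "{l..u} \<subseteq> {a..b}" "s \<in> {l..u}" "\<And>y. y \<in> {l..u} \<Longrightarrow> dist y s < d/2"
    using near[OF st(1)] by metis
  obtain l' u' where lu': "l' < u'" "{l'..u'} \<subseteq> {a..b}" "t \<in> {l'..u'}"
    "\<And>y. y \<in> {l'..u'} \<Longrightarrow> dist y t < d/2"
    using near[OF st(2)] by metis
  have "V x \<noteq> V y \<and> independent {V x, V y}" if "x \<in> {l..u}" "y \<in> {l'..u'}" for x y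
  proof (rule unit_vectors_independent)
    have xy: "x \<in> {a..b}" "y \<in> {a..b}"
      using that lu lu' by auto
    show "norm (V x) = 1" "norm (V y) = 1"
      using speed xy by (auto simp: V_def)
    have "dist (x, y) (s, t) \<le> dist x s + dist y t"
      by (simp add: dist_Pair_Pair sqrt_sum_squares_le_sum)
    also have "\<dots> < d"
      using lu(4)[OF that(1)] lu'(4)[OF that(2)] by simp
    finally have "dist (\<phi> (x, y)) (\<phi> (s, t)) < 1 - \<bar>\<phi> (s, t)\<bar>"
      using d(2)[of "(x, y)"] xy by simp
    then show "\<bar>V x \<bullet> V y\<bar> < 1"
      by (simp add: \<phi>_def dist_real_def)
  qed
  moreover have "L ` {l..u} \<inter> L ` {l'..u'} \<noteq> {}"
    using lu(3) lu'(3) \<open>L s = L t\<close> by (metis IntI empty_iff imageI)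
  ultimately show ?thesis
    unfolding has_transversal_restrictions_def V_def
    using lu(1,2) lu'(1,2) by blast
qed

text \<open>Reversing time about \<pi> and reflecting along \<open>e\<close> yields a solution with
  the same values at \<pi>, hence the same solution. At a return to the mirror, \<open>L t\<close>
  is fixed by the reflection and so is also reached at \<open>2*pi - t\<close>.\<close>

lemma frenet_self_intersection:
  fixes L V N :: "real \<Rightarrow> 'a::euclidean_space"
  assumes F: "frenet c (\<lambda>t. 2 - cos t) {0..2*pi} L V N" and "c > 0"
    and VV: "\<And>t. t \<in> {0..2*pi} \<Longrightarrow> V t \<bullet> V t = 1"
    and VN: "\<And>t. t \<in> {0..2*pi} \<Longrightarrow> V t \<bullet> N t = 0"
    and LV: "\<And>t. t \<in> {0..2*pi} \<Longrightarrow> L t \<bullet> V t = 0"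
  obtains s t where "s \<in> {0..2*pi}" "t \<in> {0..2*pi}" "s \<noteq> t" "L s = L t" "\<bar>V s \<bullet> V t\<bar> < 1"
proof -
  define e where "e = V pi"
  have ee: "e \<bullet> e = 1"
    using VV[of pi] by (simp add: e_def)
  define R where "R v = v - (2 * (v \<bullet> e)) *\<^sub>R e" for v
  have R: "bounded_linear R"
    unfolding R_def[abs_def]
    by (intro bounded_linear_sub bounded_linear_ident bounded_linear_scaleR_const
        bounded_linear_compose[OF bounded_linear_mult_right] bounded_linear_inner_left)
  have "frenet c (\<lambda>t. 2 - cos t) {0..2*pi} (\<lambda>t. L (2*pi - t)) (\<lambda>t. - V (2*pi - t)) (\<lambda>t. N (2*pi - t))"
    by (rule frenet_reverse[OF F]) (simp add: cos_diff)
  note F' = frenet_linear_image[OF R this]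
  have mid: "pi \<in> {0..2*pi}" "2*pi - pi = pi"
    by simp_all
  \<comment> \<open>Reversal makes the tangent at \<pi> equal to \<open>- e\<close>, and the
    reflection turns it back into \<open>e\<close>; position and conormal at \<pi> lie in the
    mirror.\<close>
  have fixed: "L pi = R (L pi)" "V pi = R (- V pi)" "N pi = R (N pi)"
    using LV[OF mid(1)] VN[OF mid(1)] ee by (simp_all add: R_def e_def inner_commute[of "N pi"] scaleR_2)
  have refl: "L t = R (L (2*pi - t)) \<and> V t = R (- V (2*pi - t))" if "t \<in> {0..2*pi}" for t
    using frenet_unique[OF F F' convex_closed_interval \<open>c > 0\<close> mid(1), unfolded mid(2), OF fixed that]
    by blast
  have deriv: "((\<lambda>t. f t \<bullet> e) has_real_derivative f' \<bullet> e) (at t within {pi..2*pi})"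
    if "(f has_vector_derivative f') (at t within {0..2*pi})" for f f' t
    using bounded_linear.has_vector_derivative[OF bounded_linear_inner_left
        has_vector_derivative_within_subset[OF that], of "{pi..2*pi}" e]
    by (simp add: has_real_derivative_iff_has_vector_derivative)
  have "t \<in> {0..2*pi}" if "t \<in> {pi..2*pi}" for t
    using that pi_ge_zero unfolding atLeastAtMost_iff by linarith
  note D = frenetD[OF F this, THEN deriv]
  obtain t where t: "pi < t" "t \<le> 2*pi" "L t \<bullet> e = 0" "V t \<bullet> e < 0" "N t \<bullet> e < 0"
  proof (rule first_return_oblique[of "\<lambda>t. L t \<bullet> e" "\<lambda>t. V t \<bullet> e" c "\<lambda>t. 2 - cos t" "\<lambda>t. N t \<bullet> e" sin])
    show "sin t < 0" if "pi < t" "t < 2*pi" for t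
      using that by (intro sin_lt_zero) auto
    show "((\<lambda>t. L t \<bullet> e) has_real_derivative V t \<bullet> e) (at t within {pi..2*pi})"
      and "((\<lambda>t. V t \<bullet> e) has_real_derivative - (c * (L t \<bullet> e)) + (2 - cos t) * (N t \<bullet> e))
        (at t within {pi..2*pi})"
      and "((\<lambda>t. N t \<bullet> e) has_real_derivative - ((2 - cos t) * (V t \<bullet> e))) (at t within {pi..2*pi})"
      and "((\<lambda>t. 2 - cos t) has_real_derivative sin t) (at t within {pi..2*pi})"
      if "t \<in> {pi..2*pi}" for t
      using D[OF that] by (simp_all only: inner_add_left inner_minus_left inner_scaleR_left)
        (auto intro!: derivative_eq_intros)
    show "L pi \<bullet> e = 0" "V pi \<bullet> e = 1" "N pi \<bullet> e = 0"
      using LV[OF mid(1)] VN[OF mid(1)] ee by (simp_all add: e_def inner_commute)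
  qed (use \<open>c > 0\<close> that in auto)
  have t': "t \<in> {0..2*pi}" "2*pi - t \<in> {0..2*pi}"
    using t(1,2) pi_gt_zero unfolding atLeastAtMost_iff by linarith+
  have "L (2*pi - t) = L t"
    using refl[OF t'(2)] t(3) by (simp add: R_def)
  moreover have "\<bar>V (2*pi - t) \<bullet> V t\<bar> < 1"
  proof -
    \<comment> \<open>The inner product of the two velocities is \<open>2 * p\<^sup>2 - 1\<close>.
      It avoids -1 because \<open>p\<close> is nonzero at the return, and 1 because the lift does
      not meet the mirror at a right angle.\<close>
    define p where "p = V t \<bullet> e"
    have "V (2*pi - t) \<bullet> V t = 2 * p\<^sup>2 - 1"
      using refl[OF t'(2)] VV[OF t'(1)]
      by (simp add: R_def p_def inner_diff_left inner_commute[of e] power2_eq_square)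
    moreover have "p\<^sup>2 > 0"
      using t(4) by (simp add: p_def)
    moreover have "p\<^sup>2 < 1"
    proof -
      \<comment> \<open>Equality in Cauchy-Schwarz would make \<open>e\<close> parallel to \<open>V t\<close>, hence orthogonal to \<open>N t\<close>.\<close>
      have "e - p *\<^sub>R V t \<noteq> 0"
      proof
        assume "e - p *\<^sub>R V t = 0"
        then have "N t \<bullet> e = p * (V t \<bullet> N t)"
          by (simp add: inner_commute)
        then show False
          using t(5) VN[OF t'(1)] by simp
      qed
      then have "(e - p *\<^sub>R V t) \<bullet> (e - p *\<^sub>R V t) > 0"
        by simp
      also have "(e - p *\<^sub>R V t) \<bullet> (e - p *\<^sub>R V t) = 1 - p\<^sup>2"
        using ee VV[OF t'(1)]
        by (simp add: inner_diff p_def inner_commute power2_eq_square algebra_simps)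
      finally show ?thesis by simp
    qed
    ultimately show ?thesis
      by (simp add: abs_less_iff)
  qed
  ultimately show thesis
    using t t' by (intro that[of "2*pi - t" t]) auto
qed

section \<open>The plane curve, its liftings and their crossings\<close>

theorem theorem3:
  fixes D :: real
  assumes "D > 0"
  shows "\<exists>\<gamma> :: real \<Rightarrow> real^2.
    regular_curve_on {0..2*pi} \<gamma> \<and>
    (\<forall>t\<in>{0..2*pi}. norm (velocity {0..2*pi} \<gamma> t) = 1) \<and>
    (\<forall>r\<in>{0<..<D}.
      (\<exists>L. is_lifting r {0..2*pi} \<gamma> L) \<and>
      (\<forall>L. is_lifting r {0..2*pi} \<gamma> L \<longrightarrow>
        \<not> inj_on L {0..2*pi} \<and> has_transversal_restrictions {0..2*pi} L))"
proof -
  let ?I = "{0..2*pi}"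
  define k :: "real \<Rightarrow> real" where "k t = 2 - cos t" for t
  \<comment> \<open>The tangent angle is an antiderivative of \<open>k\<close>, so the unit tangent
    \<open>T\<close> turns at rate \<open>k\<close>; integrating \<open>T\<close> gives the
    curve.\<close>
  define \<theta> :: "real \<Rightarrow> real" where "\<theta> t = 2 * t - sin t" for t
  define e1 e2 :: "real^2" where "e1 = vector [1, 0]" and "e2 = vector [0, 1]"
  define T where "T t = cos (\<theta> t) *\<^sub>R e1 + sin (\<theta> t) *\<^sub>R e2" for t
  define N where "N t = - sin (\<theta> t) *\<^sub>R e1 + cos (\<theta> t) *\<^sub>R e2" for t
  define \<gamma> where "\<gamma> t = integral {0..t} T" for t
  have d\<theta>: "(\<theta> has_real_derivative k t) (at t within S)" for t S
    unfolding \<theta>_def[abs_def] k_def by (auto intro!: derivative_eq_intros)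
  have dT: "(T has_vector_derivative k t *\<^sub>R N t) (at t within ?I)" for t
    unfolding T_def[abs_def] N_def
    by (auto intro!: derivative_eq_intros d\<theta> simp: algebra_simps)
  have dN: "(N has_vector_derivative - (k t *\<^sub>R T t)) (at t within ?I)" for t
    unfolding N_def[abs_def] T_def
    by (auto intro!: derivative_eq_intros d\<theta> simp: algebra_simps)
  have "continuous_on ?I T"
    using dT by (meson continuous_on_eq_continuous_within has_vector_derivative_continuous)
  then have d\<gamma>: "(\<gamma> has_vector_derivative T t) (at t within ?I)" if "t \<in> ?I" for t
    unfolding \<gamma>_def[abs_def] using that by (rule integral_has_vector_derivative)
  \<comment> \<open>The plane is the case \<open>c = 0\<close>, so one smoothness lemma serves both
    the curve and its liftings.\<close>
  have "frenet 0 k ?I \<gamma> T N"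
    using d\<gamma> dT dN by (simp add: frenet_def)
  then have smooth: "smooth_curve_on ?I \<gamma>"
    unfolding k_def[abs_def] by (rule frenet_smooth) simp
  have velocity: "velocity ?I \<gamma> t = T t" if "t \<in> ?I" for t
    using d\<gamma>[OF that] that by (intro velocity_eqI) auto
  have acceleration: "velocity ?I (velocity ?I \<gamma>) t = k t *\<^sub>R N t" if "t \<in> ?I" for t
    using velocity_cong[OF that velocity] velocity_eqI[OF _ that dT] by simp
  have "T t \<bullet> T t = 1" for t
    by (simp add: T_def e1_def e2_def inner_vec_def sum_2 flip: power2_eq_square)
  then have norm_T: "norm (T t) = 1" for t
    by (simp add: norm_eq_sqrt_inner)
  have speed: "norm (velocity ?I \<gamma> t) = 1" if "t \<in> ?I" for t
    using velocity[OF that] norm_T by simp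
  have curvature: "plane_curvature ?I \<gamma> t = k t" if "t \<in> ?I" for t
  proof -
    have "det (vector [T t, k t *\<^sub>R N t] :: real^2^2) = k t * (cos (\<theta> t) * cos (\<theta> t) + sin (\<theta> t) * sin (\<theta> t))"
      by (simp add: det_2 T_def N_def e1_def e2_def algebra_simps del: sin_cos_squared_add3)
    then show ?thesis
      by (simp add: plane_curvature_def velocity[OF that] acceleration[OF that] norm_T)
  qed
  have lift: "\<exists>L. is_lifting r ?I \<gamma> L" if "r > 0" for r
  proof -
    have "continuous_on ?I k"
      unfolding k_def[abs_def] by (intro continuous_intros)
    \<comment> \<open>Of the two admissible initial directions (0,1,0) is taken; the conormal there
      is (1,0,0) \<times> (0,1,0) = (0,0,1).\<close>
    then obtain X U M where F: "frenet (1 / r\<^sup>2) k ?I X U M"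
      and init: "X 0 = vector [r, 0, 0]" "U 0 = vector [0, 1, 0]" "M 0 = (vector [0, 0, 1] :: real^3)"
      using frenet_exists[of 0 "2*pi" k] by (metis mult_nonneg_nonneg pi_ge_zero zero_le_numeral)
    note orth = frenet_orthonormal[OF F that _ init]
    have X: "velocity ?I X t = U t" if "t \<in> ?I" for t
      using frenetD(1)[OF F that] that by (intro velocity_eqI) auto
    have X': "velocity ?I (velocity ?I X) t = - ((1 / r\<^sup>2) *\<^sub>R X t) + k t *\<^sub>R M t" if "t \<in> ?I" for t
      using velocity_cong[OF that X] velocity_eqI[OF _ that frenetD(2)[OF F that]] by simp
    have U: "norm (U t) = 1" if "t \<in> ?I" for t
      using orth(2)[OF _ that] by (simp add: norm_eq_sqrt_inner)
    have "is_lifting r ?I \<gamma> X"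
      unfolding is_lifting_def
    proof (intro conjI ballI)
      show "smooth_curve_on ?I X"
        using F unfolding k_def[abs_def] by (rule frenet_smooth) simp
      show "X ` ?I \<subseteq> sphere 0 r"
        using orth(1) \<open>r > 0\<close> by (auto simp: norm_eq_sqrt_inner)
      show "velocity ?I X 0 \<in> span {vector [0, 1, 0]}"
        using X[of 0] init by (simp add: span_base)
      fix t assume t: "t \<in> ?I"
      show "norm (velocity ?I X t) = norm (velocity ?I \<gamma> t)"
        using X[OF t] U[OF t] speed[OF t] by simp
      \<comment> \<open>The part of the acceleration along \<open>X\<close> is orthogonal to the
        conormal \<open>M\<close>, which leaves \<open>k t\<close>.\<close>
      show "sphere_curvature r ?I X t = plane_curvature ?I \<gamma> t"
        using orth(3-5)[OF _ t]
        by (simp add: sphere_curvature_def X[OF t] X'[OF t] U[OF t] curvature[OF t] inner_diff_right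
            inner_commute[of "M t" "X t"])
    qed (fact init)
    then show ?thesis by blast
  qed
  have cross: "\<not> inj_on L ?I \<and> has_transversal_restrictions ?I L"
    if "r > 0" and L: "is_lifting r ?I \<gamma> L" for r L
  proof -
    let ?V = "velocity ?I L"
    let ?N = "\<lambda>t. cross3 (L t /\<^sub>R r) (?V t)"
    have V: "norm (?V t) = 1" if "t \<in> ?I" for t
      using L speed that by (simp add: is_lifting_def)
    \<comment> \<open>An arbitrary lifting, with either initial direction, solves the spherical
      Frenet system, so its symmetry about \<pi> is at hand.\<close>
    have "frenet (1 / r\<^sup>2) k ?I L ?V ?N" and LV: "\<And>t. t \<in> ?I \<Longrightarrow> L t \<bullet> ?V t = 0"
      using unit_speed_sphere_frenet[of 0 "2*pi" r L k] V L \<open>r > 0\<close> curvature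
      by (auto simp: is_lifting_def)
    note F = this(1)[unfolded k_def[abs_def]]
    obtain s t where st: "s \<in> ?I" "t \<in> ?I" "s \<noteq> t" "L s = L t" "\<bar>?V s \<bullet> ?V t\<bar> < 1"
    proof (rule frenet_self_intersection[OF F])
      show "?V t \<bullet> ?V t = 1" if "t \<in> ?I" for t
        using V[OF that] by (simp flip: power2_norm_eq_inner)
    qed (use LV \<open>r > 0\<close> in \<open>auto simp: dot_cross_self\<close>)
    have "continuous_on ?I ?V"
      using frenetD(2)[OF F]
      by (meson continuous_on_eq_continuous_within has_vector_derivative_continuous)
    then have "has_transversal_restrictions ?I L"
      using V st by (intro transversal_restrictionsI[of 0 "2*pi" L s t]) auto
    then show ?thesis
      using inj_onD[of L ?I s t] st by blast
  qed
  show ?thesis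
  proof (intro exI[of _ \<gamma>] conjI ballI allI impI)
    show "regular_curve_on ?I \<gamma>"
      using smooth speed by (force simp: regular_curve_on_def)
  qed (use speed lift cross in auto)
qed

end
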